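(* Fix an integer $r\ge1$. For $n\ge r$ let $X(n;r)$ be the size (number of vertices) of the max-tree of $G_1^n$ rooted at vertex $r$. Then, as $n\to\infty$, $X(n;r)/n$ converges in distribution to the mixture of two beta distributions: the one with parameters $\alpha=1$, $\beta=r-\frac12$, with weight $\frac{1}{2r-1}$, and the one with parameters $\alpha=\frac12$, $\beta=r$, with weight $\frac{2(r-1)}{2r-1}$.
   Context: The process $\{G_1^t\}_{t\ge1}$: $G_1^1$ is a single vertex $1$ with a loop (a loop contributes $2$ to the degree); given $G_1^{t-1}$ on $[t-1]$, vertex $t$ is added together with one edge, which joins $t$ to $s\in[t-1]$ with probability $\deg_{G_1^{t-1}}(s)/(2t-1)$ and is a loop at $t$ with probability $1/(2t-1)$. The max-tree of $G_1^n$ rooted at $r$ is the tree formed by $r$ and all its descendants in $G_1^n$, i.e. all vertices $v\in[n]$ from which $r$ is reached by repeatedly following the edge from a vertex to the older vertex it attached itself to. The beta distribution with parameters $\alpha,\beta>0$ has density $\frac{\Gamma(\alpha+\beta)}{\Gamma(\alpha)\Gamma(\beta)}x^{\alpha-1}(1-x)^{\beta-1}$ on $(0,1)$. *)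

theory Defs
  imports "HOL-Probability.Probability"
begin

text \<open>
  A state of the process is the set of edges \<open>(v, s)\<close>, where \<open>v\<close> is the vertex that was added
  together with the edge and \<open>s \<le> v\<close> is the vertex it attached itself to (\<open>s = v\<close> for a loop).
  Every vertex brings exactly one edge, so there are no parallel edges.
\<close>

definition deg :: "(nat \<times> nat) set \<Rightarrow> nat \<Rightarrow> nat" where
  "deg E s = card {e \<in> E. fst e = s} + card {e \<in> E. snd e = s}"

definition attach_prob :: "nat \<Rightarrow> (nat \<times> nat) set \<Rightarrow> nat \<Rightarrow> real" where
  "attach_prob t E s =
     (if s \<in> {1..t - 1} then real (deg E s) / (2 * real t - 1)
      else if s = t then 1 / (2 * real t - 1)
      else 0)"

definition attach_pmf :: "nat \<Rightarrow> (nat \<times> nat) set \<Rightarrow> nat pmf" where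
  "attach_pmf t E = embed_pmf (attach_prob t E)"

text \<open>The law of \<open>G\<^sub>1\<^sup>t\<close>; the value at \<open>t = 0\<close> is a dummy.\<close>

fun G1 :: "nat \<Rightarrow> (nat \<times> nat) set pmf" where
  "G1 0 = return_pmf {}"
| "G1 (Suc 0) = return_pmf {(1, 1)}"
| "G1 (Suc (Suc t)) =
     bind_pmf (G1 (Suc t)) (\<lambda>E.
       map_pmf (\<lambda>s. insert (Suc (Suc t), s) E) (attach_pmf (Suc (Suc t)) E))"

definition max_tree :: "nat \<Rightarrow> (nat \<times> nat) set \<Rightarrow> nat \<Rightarrow> nat set" where
  "max_tree n E r = {v \<in> {1..n}. (v, r) \<in> E\<^sup>*}"

definition beta_density :: "real \<Rightarrow> real \<Rightarrow> real \<Rightarrow> real" where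
  "beta_density a b x =
     (if 0 < x \<and> x < 1
      then Gamma (a + b) / (Gamma a * Gamma b) * x powr (a - 1) * (1 - x) powr (b - 1)
      else 0)"

definition beta_dist :: "real \<Rightarrow> real \<Rightarrow> real measure" where
  "beta_dist a b = density lborel (\<lambda>x. ennreal (beta_density a b x))"

definition mixture :: "real \<Rightarrow> 'a measure \<Rightarrow> real \<Rightarrow> 'a measure \<Rightarrow> 'a measure" where
  "mixture p M q N =
     measure_of (space M) (sets M) (\<lambda>A. ennreal p * emeasure M A + ennreal q * emeasure N A)"

text \<open>\<open>embed_pmf\<close> and \<open>measure_of\<close> carry side conditions; the following facts
  discharge them where the constructions above are used.\<close>

lemma pmf_attach_pmf':
  assumes fin: "finite E" and f: "fst ` E \<subseteq> {1..Suc t}" and s: "snd ` E \<subseteq> {1..Suc t}"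
    and c: "card E = Suc t"
  shows "pmf (attach_pmf (Suc (Suc t)) E) v = attach_prob (Suc (Suc t)) E v"
proof -
  let ?p = "attach_prob (Suc (Suc t)) E"
  have nn: "?p x \<ge> 0" for x by (simp add: attach_prob_def)
  have group: "(\<Sum>x\<in>{1..Suc t}. card {e \<in> E. g e = x}) = Suc t"
    if "g ` E \<subseteq> {1..Suc t}" for g :: "nat \<times> nat \<Rightarrow> nat"
    using sum.group[OF fin _ that, of "\<lambda>_. 1::nat"] c by simp
  have "(\<Sum>x\<in>{1..Suc t}. deg E x) = 2 * Suc t"
    using group[OF f] group[OF s] by (simp only: deg_def sum.distrib mult_2)
  then have d: "(\<Sum>x\<in>{1..Suc t}. real (deg E x)) = 2 * real (Suc t)"
    by (metis of_nat_sum of_nat_mult of_nat_numeral)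
  have p: "?p x = real (deg E x) / (2 * real t + 3)" if "x \<in> {1..Suc t}" for x
    using that by (simp add: attach_prob_def)
  have "(\<Sum>x\<in>{1..Suc (Suc t)}. ?p x) = (\<Sum>x\<in>{1..Suc t}. ?p x) + ?p (Suc (Suc t))"
    by (rule sum.cl_ivl_Suc[THEN trans]) simp
  also have "(\<Sum>x\<in>{1..Suc t}. ?p x) = 2 * real (Suc t) / (2 * real t + 3)"
    unfolding d[symmetric] sum_divide_distrib by (rule sum.cong[OF refl p])
  also have "?p (Suc (Suc t)) = 1 / (2 * real t + 3)"
    by (simp add: attach_prob_def)
  also have "2 * real (Suc t) / (2 * real t + 3) + 1 / (2 * real t + 3) = 1"
    by (simp add: field_simps)
  finally have sum1: "(\<Sum>x\<in>{1..Suc (Suc t)}. ?p x) = 1" .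
  have "(\<integral>\<^sup>+x. ennreal (?p x) \<partial>count_space UNIV) = (\<Sum>x\<in>{1..Suc (Suc t)}. ennreal (?p x))"
    by (rule nn_integral_count_space') (auto simp: attach_prob_def)
  also have "\<dots> = 1"
    using sum1 nn by (simp add: sum_ennreal del: sum.cl_ivl_Suc)
  finally show ?thesis
    unfolding attach_pmf_def using nn by (intro pmf_embed_pmf) auto
qed

lemma G1_support:
  assumes "E \<in> set_pmf (G1 (Suc t))"
  shows "finite E \<and> fst ` E \<subseteq> {1..Suc t} \<and> snd ` E \<subseteq> {1..Suc t} \<and> card E = Suc t"
  using assms
proof (induction t arbitrary: E)
  case 0
  then show ?case by simp
next
  case (Suc t)
  then obtain F s where F: "F \<in> set_pmf (G1 (Suc t))"
    and s: "s \<in> set_pmf (attach_pmf (Suc (Suc t)) F)" and E: "E = insert (Suc (Suc t), s) F"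
    by auto
  note IH = Suc.IH[OF F]
  have "attach_prob (Suc (Suc t)) F s \<noteq> 0"
    using s IH by (simp add: set_pmf_iff pmf_attach_pmf')
  then have "s \<in> {1..Suc (Suc t)}"
    by (auto simp: attach_prob_def split: if_splits)
  moreover have "(Suc (Suc t), s) \<notin> F"
    using IH by force
  ultimately show ?case
    using IH by (auto simp: E)
qed

lemma pmf_attach_pmf:
  assumes "E \<in> set_pmf (G1 (Suc t))"
  shows "pmf (attach_pmf (Suc (Suc t)) E) s = attach_prob (Suc (Suc t)) E s"
  using G1_support[OF assms] by (intro pmf_attach_pmf') auto

lemma emeasure_mixture:
  assumes [simp]: "sets N = sets M" and "A \<in> sets M"
  shows "emeasure (mixture p M q N) A = ennreal p * emeasure M A + ennreal q * emeasure N A"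
proof (rule emeasure_measure_of[OF mixture_def])
  let ?\<mu> = "\<lambda>A. ennreal p * emeasure M A + ennreal q * emeasure N A"
  show "sets M \<subseteq> Pow (space M)" by (rule sets.space_closed)
  show "A \<in> sets (mixture p M q N)" using assms by (simp add: mixture_def)
  show "positive (sets (mixture p M q N)) ?\<mu>" by (simp add: positive_def)
  show "countably_additive (sets (mixture p M q N)) ?\<mu>"
    unfolding countably_additive_def
    by (auto simp: mixture_def suminf_add[symmetric] suminf_emeasure)
qed

end

theory Submission imports Defs begin

text \<open>
  The total degree of the max-tree rooted at \<open>r\<close> is twice its size, less one unless \<open>r\<close> carries a
  loop. Its size therefore evolves as a Polya urn whose initial composition depends only on whether
  \<open>r\<close> attached to itself, which happens with probability \<open>1 / (2 r - 1)\<close>. In each of the two cases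
  the size of the tree after \<open>N\<close> further steps is one plus a beta-binomial variable, that is, a binomial
  variable whose success probability is beta distributed. The expectation of a test function is
  thus the beta integral of its Bernstein polynomial (up to a vanishing perturbation of the nodes),
  and the uniform convergence of Bernstein polynomials gives the weak limit.
\<close>

section \<open>The beta-binomial distribution\<close>

text \<open>For positive \<open>a\<close> and \<open>b\<close>, the mass function of the number of
  successes in \<open>N\<close> trials whose common success probability is drawn from the beta
  distribution with these parameters.\<close>

definition beta_binomial :: "real \<Rightarrow> real \<Rightarrow> nat \<Rightarrow> nat \<Rightarrow> real" where
  "beta_binomial a b N k = real (N choose k) * Beta (a + real k) (b + real (N - k)) / Beta a b"

lemma Beta_real_pos: "a > 0 \<Longrightarrow> b > 0 \<Longrightarrow> Beta a b > (0::real)"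
  by (simp add: Beta_def Gamma_real_pos)

lemma beta_binomial_0_0: "a > 0 \<Longrightarrow> b > 0 \<Longrightarrow> beta_binomial a b 0 0 = 1"
  using Beta_real_pos[of a b] by (simp add: beta_binomial_def)

text \<open>One step of a Polya urn: after \<open>k\<close> successes in \<open>N\<close> draws the next draw succeeds
  with probability \<open>(a + k) / (a + b + N)\<close>.\<close>

lemma beta_binomial_step:
  fixes h :: "nat \<Rightarrow> real"
  assumes a: "a > 0" and b: "b > 0"
  defines "p \<equiv> \<lambda>N k. (a + real k) / (a + b + real N)"
  shows "(\<Sum>k\<le>N. beta_binomial a b N k * (p N k * h (Suc k) + (1 - p N k) * h k)) =
         (\<Sum>k\<le>Suc N. beta_binomial a b (Suc N) k * h k)"
proof -
  define B where "B j k = Beta (a + real j) (b + real k) / Beta a b" for j k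
  \<comment> \<open>\<open>left\<close> and \<open>right\<close> are the two recursions of the Beta
    function: a success raises its first argument by one, a failure its second.\<close>
  have left: "p N k * B k (N - k) = B (Suc k) (N - k)" if "k \<le> N" for k
  proof -
    have "a + real k \<notin> \<int>\<^sub>\<le>\<^sub>0" using a by (auto dest: nonpos_Ints_nonpos)
    from Beta_plus1_left[OF this, of "b + real (N - k)"]
    have eq: "(a + b + real N) * Beta (a + real k + 1) (b + real (N - k)) =
        (a + real k) * Beta (a + real k) (b + real (N - k))"
      using that by (simp add: of_nat_diff algebra_simps)
    have "p N k * B k (N - k) =
        (a + real k) * Beta (a + real k) (b + real (N - k)) / ((a + b + real N) * Beta a b)"
      by (simp add: B_def p_def)
    also have "\<dots> = B (Suc k) (N - k)"
      unfolding eq[symmetric] using a b by (simp add: B_def add_ac)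
    finally show ?thesis .
  qed
  have right: "(1 - p N k) * B k (N - k) = B k (Suc (N - k))" if "k \<le> N" for k
  proof -
    have "b + real (N - k) \<notin> \<int>\<^sub>\<le>\<^sub>0" using b by (auto dest: nonpos_Ints_nonpos)
    from Beta_plus1_right[OF this, of "a + real k"]
    have eq: "(a + b + real N) * Beta (a + real k) (b + real (N - k) + 1) =
        (b + real (N - k)) * Beta (a + real k) (b + real (N - k))"
      using that by (simp add: of_nat_diff algebra_simps)
    have "1 - p N k = (b + real (N - k)) / (a + b + real N)"
      using a b that by (simp add: p_def of_nat_diff field_simps)
    then have "(1 - p N k) * B k (N - k) =
        (b + real (N - k)) * Beta (a + real k) (b + real (N - k)) / ((a + b + real N) * Beta a b)"
      by (simp add: B_def)
    also have "\<dots> = B k (Suc (N - k))"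
      unfolding eq[symmetric] using a b by (simp add: B_def add_ac)
    finally show ?thesis .
  qed
  have bb: "beta_binomial a b M k = real (M choose k) * B k (M - k)" for M k
    by (simp add: beta_binomial_def B_def)
  have "(\<Sum>k\<le>N. beta_binomial a b N k * (p N k * h (Suc k) + (1 - p N k) * h k)) =
        (\<Sum>k\<le>N. real (N choose k) * (p N k * B k (N - k)) * h (Suc k)
               + real (N choose k) * ((1 - p N k) * B k (N - k)) * h k)"
    unfolding bb by (intro sum.cong refl) (simp add: algebra_simps)
  also have "\<dots> = (\<Sum>k\<le>N. real (N choose k) * B (Suc k) (N - k) * h (Suc k)) +
                  (\<Sum>k\<le>N. real (N choose k) * B k (Suc N - k) * h k)"
    unfolding sum.distrib[symmetric]
    by (intro sum.cong refl) (simp add: left right Suc_diff_le)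
  \<comment> \<open>The added term vanishes because \<open>N choose Suc N\<close> is zero. Splitting
    off \<open>k = 0\<close> then aligns both sums at \<open>Suc k\<close>, where Pascal's rule
    joins the coefficients.\<close>
  also have "(\<Sum>k\<le>N. real (N choose k) * B k (Suc N - k) * h k) =
             (\<Sum>k\<le>Suc N. real (N choose k) * B k (Suc N - k) * h k)"
    by simp
  also have "\<dots> = B 0 (Suc N) * h 0 +
      (\<Sum>k\<le>N. real (N choose Suc k) * B (Suc k) (N - k) * h (Suc k))"
    by (subst sum.atMost_Suc_shift) simp
  also have "(\<Sum>k\<le>N. real (N choose k) * B (Suc k) (N - k) * h (Suc k)) + \<dots> =
      (\<Sum>k\<le>Suc N. beta_binomial a b (Suc N) k * h k)"
    unfolding bb by (subst sum.atMost_Suc_shift) (simp add: sum.distrib[symmetric] algebra_simps)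
  finally show ?thesis .
qed

section \<open>Beta integrals of Bernstein polynomials\<close>

lemma beta_density_nonneg: "a > 0 \<Longrightarrow> b > 0 \<Longrightarrow> beta_density a b x \<ge> 0"
  by (simp add: beta_density_def Gamma_real_pos)

lemma borel_measurable_beta_density [measurable]: "beta_density a b \<in> borel_measurable borel"
  unfolding beta_density_def[abs_def] by measurable

text \<open>The monomial factors only shift the parameters: up to normalization the integrand is the
  beta density with parameters \<open>a + j\<close> and \<open>b + k\<close>.\<close>

lemma has_bochner_integral_beta_density_moment:
  assumes a: "a > 0" and b: "b > 0"
  shows "has_bochner_integral lborel (\<lambda>x. x ^ j * (1 - x) ^ k * beta_density a b x)
           (Beta (a + real j) (b + real k) / Beta a b)"
proof (rule has_bochner_integral_nn_integral)
  let ?f = "\<lambda>x. x ^ j * (1 - x) ^ k * beta_density a b x"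
  show "?f \<in> borel_measurable lborel" by measurable
  show "AE x in lborel. 0 \<le> ?f x"
    using a b by (auto simp: beta_density_def Gamma_real_pos less_imp_le)
  show "0 \<le> Beta (a + real j) (b + real k) / Beta a b"
    using a b by (simp add: Beta_real_pos less_imp_le)
  \<comment> \<open>On the open interval the bases \<open>x\<close> and \<open>1 - x\<close> are
    positive, so natural and real powers can be merged; the density vanishes outside it.\<close>
  have "((\<lambda>x. inverse (Beta a b) * (x powr (a + real j - 1) * (1 - x) powr (b + real k - 1)))
      has_integral inverse (Beta a b) * Beta (a + real j) (b + real k)) {0<..<1}"
    using has_integral_Beta_real[of "a + real j" "b + real k"] a b
    by (intro has_integral_mult_right) (simp add: has_integral_Icc_iff_Ioo)
  moreover have "inverse (Beta a b) * (x powr (a + real j - 1) * (1 - x) powr (b + real k - 1)) = ?f x"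
    if "x \<in> {0<..<1}" for x
  proof -
    have "x powr (a + real j - 1) = x ^ j * x powr (a - 1)"
      using that powr_add[of x "real j" "a - 1"] by (simp add: powr_realpow algebra_simps)
    moreover have "(1 - x) powr (b + real k - 1) = (1 - x) ^ k * (1 - x) powr (b - 1)"
      using that powr_add[of "1 - x" "real k" "b - 1"] by (simp add: powr_realpow algebra_simps)
    ultimately show ?thesis
      using that by (simp add: beta_density_def Beta_def)
  qed
  ultimately have "(?f has_integral inverse (Beta a b) * Beta (a + real j) (b + real k)) {0<..<1}"
    by (subst has_integral_cong[symmetric])
  then have "(\<integral>\<^sup>+x. ennreal (?f x) * indicator {0<..<1} x \<partial>lborel) =
      ennreal (inverse (Beta a b) * Beta (a + real j) (b + real k))"
    using beta_density_nonneg[OF a b]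
    by (intro nn_integral_has_integral_lebesgue') auto
  also have "(\<integral>\<^sup>+x. ennreal (?f x) * indicator {0<..<1} x \<partial>lborel) = (\<integral>\<^sup>+x. ennreal (?f x) \<partial>lborel)"
    by (intro nn_integral_cong) (auto simp: beta_density_def split: split_indicator)
  finally show "(\<integral>\<^sup>+x. ennreal (?f x) \<partial>lborel) = ennreal (Beta (a + real j) (b + real k) / Beta a b)"
    by (simp add: divide_inverse mult.commute)
qed

lemma has_bochner_integral_beta_density:
  "a > 0 \<Longrightarrow> b > 0 \<Longrightarrow> has_bochner_integral lborel (beta_density a b) 1"
  using has_bochner_integral_beta_density_moment[of a b 0 0] Beta_real_pos[of a b] by simp

text \<open>Given success probability \<open>x\<close>, \<open>Bernstein N k x\<close> is the
  binomial probability of \<open>k\<close> successes. Integrating \<open>x\<close> out against the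
  beta density gives the beta-binomial weights.\<close>

lemma has_bochner_integral_beta_binomial:
  assumes "a > 0" "b > 0"
  shows "has_bochner_integral lborel (\<lambda>x. (\<Sum>k\<le>N. f k * Bernstein N k x) * beta_density a b x)
           (\<Sum>k\<le>N. beta_binomial a b N k * f k)"
proof -
  have "has_bochner_integral lborel
      (\<lambda>x. \<Sum>k\<le>N. (real (N choose k) * f k) * (x ^ k * (1 - x) ^ (N - k) * beta_density a b x))
      (\<Sum>k\<le>N. (real (N choose k) * f k) * (Beta (a + real k) (b + real (N - k)) / Beta a b))"
    by (intro has_bochner_integral_sum has_bochner_integral_mult_right
        has_bochner_integral_beta_density_moment assms)
  then show ?thesis
    by (simp add: Bernstein_def beta_binomial_def sum_distrib_left mult_ac)
qed

lemma integrable_bounded_mult_beta_density: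
  fixes f :: "real \<Rightarrow> real"
  assumes "a > 0" "b > 0" "f \<in> borel_measurable borel" "\<And>x. \<bar>f x\<bar> \<le> C"
  shows "integrable lborel (\<lambda>x. f x * beta_density a b x)"
proof (rule Bochner_Integration.integrable_bound)
  show "integrable lborel (\<lambda>x. C * beta_density a b x)"
    using has_bochner_integral_beta_density[OF assms(1,2)]
    by (auto intro: integrable_mult_right simp: has_bochner_integral_iff)
  show "(\<lambda>x. f x * beta_density a b x) \<in> borel_measurable lborel"
    using assms(3) by measurable
  have "\<bar>f x\<bar> * beta_density a b x \<le> \<bar>C\<bar> * beta_density a b x" for x
    using assms(4)[of x] beta_density_nonneg[OF assms(1,2)] by (intro mult_right_mono) auto
  then show "AE x in lborel. norm (f x * beta_density a b x) \<le> norm (C * beta_density a b x)"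
    using beta_density_nonneg[OF assms(1,2)] by (simp add: abs_mult)
qed

section \<open>Convergence of beta-binomial expectations\<close>

text \<open>The nodes are the relative sizes of a tree with \<open>Suc k\<close> of
  \<open>N + r\<close> vertices. They differ from the Bernstein nodes \<open>k / N\<close> by at
  most \<open>r / (N + r)\<close>, so uniform continuity absorbs the shift.\<close>

lemma shifted_Bernstein_uniform_limit:
  fixes f :: "real \<Rightarrow> real"
  assumes f: "uniformly_continuous_on UNIV f" and r: "r \<ge> 1" and e: "e > 0"
  shows "\<exists>M. \<forall>N\<ge>M. \<forall>x\<in>{0..1}.
           \<bar>(\<Sum>k\<le>N. f (real (Suc k) / real (N + r)) * Bernstein N k x) - f x\<bar> \<le> e"
proof -
  \<comment> \<open>Half of \<open>e\<close> pays for moving the nodes, the other half for the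
    Bernstein approximation.\<close>
  obtain d where d: "d > 0" "\<And>x y. \<bar>x - y\<bar> < d \<Longrightarrow> \<bar>f x - f y\<bar> < e / 2"
    using f e unfolding uniformly_continuous_on_def dist_real_def
    by (metis UNIV_I half_gt_zero)
  have "continuous_on {0..1} f"
    using uniformly_continuous_imp_continuous[OF f] continuous_on_subset by blast
  from Bernstein_Weierstrass[OF this, of "e / 2"] e obtain M1 where
    M1: "\<And>N x. N \<ge> M1 \<Longrightarrow> x \<in> {0..1} \<Longrightarrow>
      \<bar>f x - (\<Sum>k\<le>N. f (k / N) * Bernstein N k x)\<bar> < e / 2"
    by auto
  obtain M2 :: nat where M2: "real r / d < real M2"
    using reals_Archimedean2 by blast
  show ?thesis
  proof (intro exI[of _ "max M1 (Suc M2)"] allI impI ballI)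
    fix N :: nat and x :: real
    assume N: "max M1 (Suc M2) \<le> N" and x: "x \<in> {0..1}"
    then have N0: "real N > 0" and "real r / d < real N" using M2 by auto
    then have rN: "real r / real N < d" using d(1) by (simp add: field_simps)
    have close: "\<bar>real (Suc k) / real (N + r) - real k / real N\<bar> < d" if k: "k \<le> N" for k
    proof -
      have "real (Suc k) / real (N + r) - real k / real N
          = (real N - real k * real r) / (real N * real (N + r))"
        using N0 by (simp add: field_simps)
      \<comment> \<open>Both \<open>N\<close> and \<open>k * r\<close> lie between 0 and
        \<open>N * r\<close>, because \<open>r\<close> is at least 1 and \<open>k\<close> at most
        \<open>N\<close>.\<close>
      moreover have "\<bar>real N - real k * real r\<bar> \<le> real N * real r"
      proof -
        have "real k * real r \<le> real N * real r" using k by (intro mult_right_mono) auto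
        moreover have "real N * 1 \<le> real N * real r" using r by (intro mult_left_mono) auto
        ultimately show ?thesis by (simp add: abs_le_iff) (smt (verit) mult_nonneg_nonneg of_nat_0_le_iff)
      qed
      ultimately have "\<bar>real (Suc k) / real (N + r) - real k / real N\<bar>
          \<le> real N * real r / (real N * real (N + r))"
        using N0 by (simp only: abs_divide abs_mult abs_of_nat) (intro divide_right_mono, auto)
      also have "\<dots> = real r / real (N + r)"
        using N0 by simp
      also have "\<dots> \<le> real r / real N"
        using N0 by (intro divide_left_mono) auto
      finally show ?thesis using rN by simp
    qed
    have "\<bar>(\<Sum>k\<le>N. f (real (Suc k) / real (N + r)) * Bernstein N k x)
          - (\<Sum>k\<le>N. f (k / N) * Bernstein N k x)\<bar>
        = \<bar>\<Sum>k\<le>N. (f (real (Suc k) / real (N + r)) - f (k / N)) * Bernstein N k x\<bar>"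
      by (simp only: sum_subtractf left_diff_distrib)
    also have "\<dots> \<le> (\<Sum>k\<le>N. e / 2 * Bernstein N k x)"
    proof (rule order_trans[OF sum_abs], rule sum_mono)
      fix k assume "k \<in> {..N}"
      then have "\<bar>f (real (Suc k) / real (N + r)) - f (k / N)\<bar> \<le> e / 2"
        using d(2)[OF close] by (auto intro: less_imp_le)
      then show "\<bar>(f (real (Suc k) / real (N + r)) - f (k / N)) * Bernstein N k x\<bar>
          \<le> e / 2 * Bernstein N k x"
        using x Bernstein_nonneg[of x N k] unfolding abs_mult
        by (simp only: abs_of_nonneg atLeastAtMost_iff mult_right_mono)
    qed
    also have "\<dots> = e / 2" by (simp only: sum_Bernstein mult_1_right flip: sum_distrib_left)
    finally show "\<bar>(\<Sum>k\<le>N. f (real (Suc k) / real (N + r)) * Bernstein N k x) - f x\<bar> \<le> e"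
      using M1[of N x] N x by linarith
  qed
qed

text \<open>The left side is the beta integral of the shifted Bernstein polynomial of
  \<open>f\<close>. Uniform convergence on the unit interval carries over to the integrals, since
  the density has total mass one.\<close>

lemma beta_binomial_tendsto:
  fixes f :: "real \<Rightarrow> real"
  assumes a: "a > 0" and b: "b > 0" and r: "r \<ge> 1"
    and f: "uniformly_continuous_on UNIV f" and C: "\<And>x. \<bar>f x\<bar> \<le> C"
  shows "(\<lambda>N. \<Sum>k\<le>N. beta_binomial a b N k * f (real (Suc k) / real (N + r)))
           \<longlonglongrightarrow> (LINT x|lborel. f x * beta_density a b x)"
proof (rule LIMSEQ_I)
  fix e :: real assume e: "e > 0"
  \<comment> \<open>The uniform bound is not strict; halving \<open>e\<close> makes the final
    inequality strict.\<close>
  then have "e / 2 > 0" by simp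
  from shifted_Bernstein_uniform_limit[OF f r this] obtain M where M: "\<And>N x. N \<ge> M \<Longrightarrow> x \<in> {0..1} \<Longrightarrow>
      \<bar>(\<Sum>k\<le>N. f (real (Suc k) / real (N + r)) * Bernstein N k x) - f x\<bar> \<le> e / 2"
    by blast
  have fm: "f \<in> borel_measurable borel"
    using uniformly_continuous_imp_continuous[OF f] by (rule borel_measurable_continuous_onI)
  have If: "integrable lborel (\<lambda>x. f x * beta_density a b x)"
    by (rule integrable_bounded_mult_beta_density[OF a b fm C])
  show "\<exists>M. \<forall>N\<ge>M. norm ((\<Sum>k\<le>N. beta_binomial a b N k * f (real (Suc k) / real (N + r)))
      - (LINT x|lborel. f x * beta_density a b x)) < e"
  proof (intro exI[of _ M] allI impI)
    fix N assume N: "N \<ge> M"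
    define g where "g x = (\<Sum>k\<le>N. f (real (Suc k) / real (N + r)) * Bernstein N k x)" for x
    have hg: "has_bochner_integral lborel (\<lambda>x. g x * beta_density a b x)
        (\<Sum>k\<le>N. beta_binomial a b N k * f (real (Suc k) / real (N + r)))"
      unfolding g_def by (rule has_bochner_integral_beta_binomial[OF a b])
    have hb: "has_bochner_integral lborel (\<lambda>x. e / 2 * beta_density a b x) (e / 2 * 1)"
      by (intro has_bochner_integral_mult_right has_bochner_integral_beta_density a b)
    have "norm (LINT x|lborel. g x * beta_density a b x - f x * beta_density a b x)
        \<le> (LINT x|lborel. e / 2 * beta_density a b x)"
    proof (rule Bochner_Integration.integral_norm_bound_integral)
      show "integrable lborel (\<lambda>x. g x * beta_density a b x - f x * beta_density a b x)"
        using hg If by (auto simp: has_bochner_integral_iff)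
      show "integrable lborel (\<lambda>x. e / 2 * beta_density a b x)"
        using hb by (auto simp: has_bochner_integral_iff)
      fix x :: real
      \<comment> \<open>The polynomial is controlled on the unit interval only; elsewhere the
        density is zero.\<close>
      have "\<bar>g x - f x\<bar> * beta_density a b x \<le> e / 2 * beta_density a b x"
      proof (cases "x \<in> {0..1}")
        case True
        then show ?thesis
          using M[OF N True] beta_density_nonneg[OF a b] unfolding g_def by (intro mult_right_mono)
      qed (auto simp: beta_density_def)
      then show "norm (g x * beta_density a b x - f x * beta_density a b x) \<le> e / 2 * beta_density a b x"
        using beta_density_nonneg[OF a b] by (simp add: abs_mult flip: left_diff_distrib)
    qed
    then show "norm ((\<Sum>k\<le>N. beta_binomial a b N k * f (real (Suc k) / real (N + r)))
        - (LINT x|lborel. f x * beta_density a b x)) < e"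
      using hg hb If e by (simp add: has_bochner_integral_iff)
  qed
qed

section \<open>Mixtures of beta distributions\<close>

text \<open>Turns the mixture, given as a set function, into one density, so that its total mass and
  its integrals become Lebesgue integrals.\<close>

lemma mixture_beta_dist_eq_density:
  assumes p: "p \<ge> 0" and q: "q \<ge> 0" and "a > 0" "b > 0" "c > 0" "d > 0"
  shows "mixture p (beta_dist a b) q (beta_dist c d) =
    density lborel (\<lambda>x. ennreal (p * beta_density a b x + q * beta_density c d x))"
proof (rule measure_eqI)
  show "sets (mixture p (beta_dist a b) q (beta_dist c d)) =
      sets (density lborel (\<lambda>x. ennreal (p * beta_density a b x + q * beta_density c d x)))"
    by (simp add: mixture_def beta_dist_def sets.sigma_sets_eq[of borel, simplified])
  fix A assume "A \<in> sets (mixture p (beta_dist a b) q (beta_dist c d))"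
  then have A [measurable]: "A \<in> sets borel"
    by (simp add: mixture_def beta_dist_def sets.sigma_sets_eq[of borel, simplified])
  have "emeasure (mixture p (beta_dist a b) q (beta_dist c d)) A =
      ennreal p * (\<integral>\<^sup>+x. ennreal (beta_density a b x) * indicator A x \<partial>lborel) +
      ennreal q * (\<integral>\<^sup>+x. ennreal (beta_density c d x) * indicator A x \<partial>lborel)"
    using A by (subst emeasure_mixture) (simp_all add: beta_dist_def emeasure_density)
  also have "\<dots> = (\<integral>\<^sup>+x. ennreal p * (ennreal (beta_density a b x) * indicator A x) +
      ennreal q * (ennreal (beta_density c d x) * indicator A x) \<partial>lborel)"
    by (simp add: nn_integral_add nn_integral_cmult)
  also have "\<dots> = (\<integral>\<^sup>+x. ennreal (p * beta_density a b x + q * beta_density c d x) * indicator A x \<partial>lborel)"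
    using assms by (intro nn_integral_cong)
      (auto simp: beta_density_nonneg ennreal_mult ennreal_plus split: split_indicator)
  also have "\<dots> = emeasure (density lborel (\<lambda>x. ennreal (p * beta_density a b x + q * beta_density c d x))) A"
    by (simp add: emeasure_density)
  finally show "emeasure (mixture p (beta_dist a b) q (beta_dist c d)) A = \<dots>" .
qed

lemma real_distribution_mixture_beta_dist:
  assumes "p \<ge> 0" "q \<ge> 0" "p + q = 1" "a > 0" "b > 0" "c > 0" "d > 0"
  shows "real_distribution (mixture p (beta_dist a b) q (beta_dist c d))"
proof -
  let ?g = "\<lambda>x. p * beta_density a b x + q * beta_density c d x"
  have "has_bochner_integral lborel ?g (p * 1 + q * 1)"
    using assms by (intro has_bochner_integral_add has_bochner_integral_mult_right
        has_bochner_integral_beta_density)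
  then have "(\<integral>\<^sup>+x. ennreal (?g x) \<partial>lborel) = 1"
    using assms
    by (subst nn_integral_eq_integral) (auto simp: has_bochner_integral_iff beta_density_nonneg)
  then have "prob_space (density lborel (\<lambda>x. ennreal (?g x)))"
    by (intro prob_spaceI) (simp add: emeasure_density)
  then show ?thesis
    unfolding mixture_beta_dist_eq_density[OF assms(1,2,4-7)]
      real_distribution_def real_distribution_axioms_def by simp
qed

lemma integral_mixture_beta_dist:
  fixes f :: "real \<Rightarrow> real"
  assumes "p \<ge> 0" "q \<ge> 0" "a > 0" "b > 0" "c > 0" "d > 0"
    and [measurable]: "f \<in> borel_measurable borel" and C: "\<And>x. \<bar>f x\<bar> \<le> C"
  shows "integral\<^sup>L (mixture p (beta_dist a b) q (beta_dist c d)) f =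
    p * (LINT x|lborel. f x * beta_density a b x) + q * (LINT x|lborel. f x * beta_density c d x)"
proof -
  have "integral\<^sup>L (mixture p (beta_dist a b) q (beta_dist c d)) f =
      (LINT x|lborel. (p * beta_density a b x + q * beta_density c d x) * f x)"
    using assms by (subst mixture_beta_dist_eq_density, simp_all)
      (subst integral_density, auto simp: beta_density_nonneg)
  also have "\<dots> = (LINT x|lborel. p * (f x * beta_density a b x) + q * (f x * beta_density c d x))"
    by (intro Bochner_Integration.integral_cong) (auto simp: algebra_simps)
  also have "\<dots> = p * (LINT x|lborel. f x * beta_density a b x) + q * (LINT x|lborel. f x * beta_density c d x)"
    using assms by (subst Bochner_Integration.integral_add)
      (auto intro!: integrable_mult_right integrable_bounded_mult_beta_density[where C = C])
  finally show ?thesis .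
qed

section \<open>The max-tree as a Polya urn\<close>

text \<open>The invariant that isolates the combinatorics from the probability: \<open>E\<close> is
  the graph of a parent map that never increases labels.\<close>

definition attachment_graph :: "nat \<Rightarrow> (nat \<times> nat) set \<Rightarrow> bool" where
  "attachment_graph n E \<longleftrightarrow> inj_on fst E \<and> fst ` E = {1..n} \<and> (\<forall>(v, s)\<in>E. 1 \<le> s \<and> s \<le> v)"

lemma attachment_graph_finite: "attachment_graph n E \<Longrightarrow> finite E"
  unfolding attachment_graph_def by (metis finite_atLeastAtMost finite_imageD)

lemma attachment_graph_edge:
  assumes "attachment_graph n E" "(v, s) \<in> E"
  shows "v \<in> {1..n}" "1 \<le> s" "s \<le> v"
proof -
  from assms have "fst (v, s) \<in> {1..n}"
    unfolding attachment_graph_def by blast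
  with assms show "v \<in> {1..n}" "1 \<le> s" "s \<le> v"
    unfolding attachment_graph_def by auto
qed

lemma attachment_graph_unique:
  assumes "attachment_graph n E" "(v, s) \<in> E" "(v, s') \<in> E"
  shows "s = s'"
proof -
  have "(v, s) = (v, s')"
    using assms unfolding attachment_graph_def by (intro inj_onD[of fst E]) auto
  then show ?thesis by simp
qed

lemma attachment_graph_rtrancl_le:
  assumes "attachment_graph n E" "(v, w) \<in> E\<^sup>*"
  shows "w \<le> v"
  using assms(2) by induction (use attachment_graph_edge[OF assms(1)] in fastforce)+

lemma attachment_graph_insert:
  assumes E: "attachment_graph n E" and s: "s \<in> {1..Suc n}"
  shows "attachment_graph (Suc n) (insert (Suc n, s) E)"
  unfolding attachment_graph_def
proof (intro conjI)
  have "Suc n \<notin> fst ` (E - {(Suc n, s)})"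
    using attachment_graph_edge(1)[OF E] by fastforce
  then show "inj_on fst (insert (Suc n, s) E)"
    using E unfolding attachment_graph_def inj_on_insert by (simp only: fst_conv simp_thms)
  show "fst ` insert (Suc n, s) E = {1..Suc n}"
    using E unfolding attachment_graph_def by auto
  show "\<forall>(v, s)\<in>insert (Suc n, s) E. 1 \<le> s \<and> s \<le> v"
    using E s unfolding attachment_graph_def by auto
qed

lemma max_tree_finite [simp]: "finite (max_tree n E r)"
  by (simp add: max_tree_def)

text \<open>In \<open>E\<close> the vertex \<open>Suc n\<close> is isolated, so the new edge creates
  paths to \<open>r\<close> from \<open>Suc n\<close> only, and these continue from
  \<open>s\<close>.\<close>

lemma max_tree_insert:
  assumes E: "attachment_graph n E" and r: "r \<in> {1..n}"
  shows "max_tree (Suc n) (insert (Suc n, s) E) r =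
    (if s \<in> max_tree n E r then insert (Suc n) (max_tree n E r) else max_tree n E r)"
proof -
  note edge = attachment_graph_edge[OF E]
  have to_new: "x = Suc n" if "(x, Suc n) \<in> E\<^sup>*" for x
    using that by (cases rule: rtranclE) (use edge in fastforce)+
  have from_new: "y = Suc n" if "(Suc n, y) \<in> E\<^sup>*" for y
    using that by (cases rule: converse_rtranclE) (use edge in fastforce)+
  \<comment> \<open>The range restriction in \<open>max_tree\<close> is thus automatic, and
    membership reduces to reachability.\<close>
  have dom: "x \<in> {1..n}" if "(x, r) \<in> E\<^sup>*" for x
    using that by (cases rule: converse_rtranclE) (use edge(1) r in auto)
  have "(x, r) \<in> (insert (Suc n, s) E)\<^sup>* \<longleftrightarrow> (x, r) \<in> E\<^sup>* \<or> (x = Suc n \<and> (s, r) \<in> E\<^sup>*)" for x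
    unfolding rtrancl_insert using to_new by auto
  then have "x \<in> max_tree (Suc n) (insert (Suc n, s) E) r \<longleftrightarrow>
      (x, r) \<in> E\<^sup>* \<or> (x = Suc n \<and> (s, r) \<in> E\<^sup>*)" for x
    using dom[of x] by (auto simp: max_tree_def)
  moreover have "x \<in> max_tree n E r \<longleftrightarrow> (x, r) \<in> E\<^sup>*" for x
    using dom[of x] by (auto simp: max_tree_def)
  ultimately show ?thesis
    by (simp add: set_eq_iff) blast
qed

text \<open>Every edge starting in the max-tree also ends in it, except the edge from the root when that
  edge is not a loop.\<close>

lemma sum_deg_max_tree:
  assumes E: "attachment_graph n E" and r: "r \<in> {1..n}"
  shows "(\<Sum>s\<in>max_tree n E r. deg E s) + of_bool ((r, r) \<notin> E) = 2 * card (max_tree n E r)"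
proof -
  define T where "T = max_tree n E r"
  define A where "A = {e \<in> E. fst e \<in> T}"
  define B where "B = {e \<in> E. snd e \<in> T}"
  note fin = attachment_graph_finite[OF E]
  note edge = attachment_graph_edge[OF E]
  have T: "finite T" by (simp add: T_def)
  \<comment> \<open>Used with \<open>fst\<close> and \<open>snd\<close>: the degree sum over
    \<open>T\<close> counts the edges with tail in \<open>T\<close> (the set \<open>A\<close>) and
    those with head in \<open>T\<close> (the set \<open>B\<close>).\<close>
  have count: "(\<Sum>s\<in>T. card {e \<in> E. g e = s}) = card {e \<in> E. g e \<in> T}" for g :: "nat \<times> nat \<Rightarrow> nat"
  proof -
    have "(\<Sum>s\<in>T. card {e \<in> E. g e = s}) = (\<Sum>s\<in>T. \<Sum>e\<in>{e \<in> {e \<in> E. g e \<in> T}. g e = s}. 1)"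
      by (intro sum.cong refl) (auto intro!: arg_cong[where f = card])
    also have "\<dots> = card {e \<in> E. g e \<in> T}"
      using fin T by (subst sum.group) auto
    finally show ?thesis .
  qed
  have "fst ` A = T"
  proof
    show "T \<subseteq> fst ` A"
    proof
      fix v assume v: "v \<in> T"
      then have "v \<in> fst ` E"
        using E by (auto simp: T_def max_tree_def attachment_graph_def)
      with v show "v \<in> fst ` A" by (auto simp: A_def)
    qed
  qed (auto simp: A_def)
  moreover have "inj_on fst A"
    using E unfolding attachment_graph_def A_def by (auto intro: inj_on_subset)
  ultimately have cardA: "card A = card T"
    using card_image by metis
  have T_closed: "v \<in> T" if "(v, s) \<in> E" "s \<in> T" for v s
    using that edge by (auto simp: T_def max_tree_def intro: converse_rtrancl_into_rtrancl)
  have T_step: "s \<in> T" if vs: "(v, s) \<in> E" and v: "v \<in> T" "v \<noteq> r" for v s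
  proof -
    from v have "(v, r) \<in> E\<^sup>*" by (simp add: T_def max_tree_def)
    then obtain s' where s': "(v, s') \<in> E" "(s', r) \<in> E\<^sup>*"
      using v(2) by (auto elim: converse_rtranclE)
    then have "s' = s" using attachment_graph_unique[OF E] vs by blast
    with s' show ?thesis using edge[OF vs] by (auto simp: T_def max_tree_def)
  qed
  have rT: "r \<in> T" using r by (simp add: T_def max_tree_def)
  \<comment> \<open>The edge gives that \<open>s\<close> is at most \<open>r\<close>, the path from
    \<open>s\<close> back to \<open>r\<close> gives the converse; an edge from the root into the
    tree is therefore a loop.\<close>
  have root: "s = r" if "(r, s) \<in> E" "s \<in> T" for s
    using that edge[of r s] attachment_graph_rtrancl_le[OF E, of s r]
    by (auto simp: T_def max_tree_def)
  \<comment> \<open>A loop at the root lies in both \<open>A\<close> and \<open>B\<close>. Otherwise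
    the edge of the root is the one element of \<open>A\<close> outside \<open>B\<close>.\<close>
  have cardB: "card B + of_bool ((r, r) \<notin> E) = card A"
  proof (cases "(r, r) \<in> E")
    case True
    have "s \<in> T" if "(v, s) \<in> E" "v \<in> T" for v s
    proof (cases "v = r")
      case True
      with \<open>(r, r) \<in> E\<close> that show ?thesis
        using attachment_graph_unique[OF E that(1), of r] rT by simp
    qed (rule T_step[OF that])
    then have "A = B"
      using T_closed by (auto simp: A_def B_def)
    with True show ?thesis by simp
  next
    case False
    have "r \<in> fst ` E"
      using r E by (auto simp: attachment_graph_def)
    then obtain s where s: "(r, s) \<in> E" by auto
    have "(r, s) \<notin> B" using root[OF s] s False by (auto simp: B_def)
    moreover have "A = insert (r, s) B"
    proof (intro equalityI subsetI)
      fix e assume "e \<in> A"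
      then show "e \<in> insert (r, s) B"
        using T_step attachment_graph_unique[OF E s] by (cases e; cases "fst e = r") (auto simp: A_def B_def)
    next
      fix e assume "e \<in> insert (r, s) B"
      then show "e \<in> A" using T_closed[of "fst e" "snd e"] s rT by (auto simp: A_def B_def)
    qed
    moreover have "finite B" using fin by (simp add: B_def)
    ultimately show ?thesis using False by simp
  qed
  have "(\<Sum>s\<in>T. deg E s) = card A + card B"
    by (simp add: deg_def sum.distrib count A_def B_def)
  then show ?thesis
    using cardA cardB by (simp add: T_def)
qed

section \<open>Transition probabilities of the process\<close>

lemma G1_Suc:
  "n \<ge> 1 \<Longrightarrow> G1 (Suc n) =
     bind_pmf (G1 n) (\<lambda>E. map_pmf (\<lambda>s. insert (Suc n, s) E) (attach_pmf (Suc n) E))"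
  by (cases n) auto

lemma pmf_attach_pmf_G1:
  "n \<ge> 1 \<Longrightarrow> E \<in> set_pmf (G1 n) \<Longrightarrow> pmf (attach_pmf (Suc n) E) s = attach_prob (Suc n) E s"
  by (cases n) (auto intro: pmf_attach_pmf)

lemma set_attach_pmf_subset:
  assumes "n \<ge> 1" "E \<in> set_pmf (G1 n)"
  shows "set_pmf (attach_pmf (Suc n) E) \<subseteq> {1..Suc n}"
  using assms by (auto simp: set_pmf_iff pmf_attach_pmf_G1 attach_prob_def split: if_splits)

lemma attachment_graph_G1:
  assumes "n \<ge> 1" "E \<in> set_pmf (G1 n)"
  shows "attachment_graph n E"
  using assms
proof (induction n arbitrary: E rule: dec_induct)
  case base
  then show ?case by (simp add: attachment_graph_def)
next
  case (step n)
  then obtain F s where "F \<in> set_pmf (G1 n)" "s \<in> set_pmf (attach_pmf (Suc n) F)"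
    "E = insert (Suc n, s) F"
    by (auto simp: G1_Suc)
  then show ?case
    using step set_attach_pmf_subset[of n F] by (auto intro!: attachment_graph_insert)
qed

text \<open>Finite support turns expectations over the process into finite sums.\<close>

lemma finite_set_pmf_G1: "n \<ge> 1 \<Longrightarrow> finite (set_pmf (G1 n))"
proof (induction n rule: dec_induct)
  case (step n)
  then show ?case
    using finite_subset[OF set_attach_pmf_subset[of n]] by (auto simp: G1_Suc)
qed simp

lemma expectation_G1_Suc:
  fixes h :: "(nat \<times> nat) set \<Rightarrow> real"
  assumes n: "n \<ge> 1"
  shows "measure_pmf.expectation (G1 (Suc n)) h =
    measure_pmf.expectation (G1 n)
      (\<lambda>E. measure_pmf.expectation (attach_pmf (Suc n) E) (\<lambda>s. h (insert (Suc n, s) E)))"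
proof -
  have "measure_pmf.expectation (G1 (Suc n)) h = (\<Sum>E\<in>set_pmf (G1 n). pmf (G1 n) E *\<^sub>R
      measure_pmf.expectation (map_pmf (\<lambda>s. insert (Suc n, s) E) (attach_pmf (Suc n) E)) h)"
    unfolding G1_Suc[OF n]
    using finite_set_pmf_G1[OF n] finite_subset[OF set_attach_pmf_subset[OF n]]
    by (intro pmf_expectation_bind) auto
  also have "\<dots> = measure_pmf.expectation (G1 n)
      (\<lambda>E. measure_pmf.expectation (attach_pmf (Suc n) E) (\<lambda>s. h (insert (Suc n, s) E)))"
    using finite_set_pmf_G1[OF n] by (subst integral_measure_pmf[of "set_pmf (G1 n)"]) auto
  finally show ?thesis .
qed

text \<open>The probability is the degree sum of the tree over \<open>2 * n + 1\<close>. Halving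
  numerator and denominator gives the form of an urn in which each new tree vertex adds weight
  one.\<close>

lemma prob_attach_max_tree:
  assumes E: "E \<in> set_pmf (G1 n)" and r: "r \<in> {1..n}"
  shows "measure_pmf.prob (attach_pmf (Suc n) E) (max_tree n E r) =
    (real (card (max_tree n E r)) - of_bool ((r, r) \<notin> E) / 2) / (real n + 1 / 2)"
proof -
  have n: "n \<ge> 1" using r by auto
  have "measure_pmf.prob (attach_pmf (Suc n) E) (max_tree n E r) =
      (\<Sum>s\<in>max_tree n E r. real (deg E s) / (2 * real (Suc n) - 1))"
    unfolding measure_measure_pmf_finite[OF max_tree_finite] pmf_attach_pmf_G1[OF n E]
    by (intro sum.cong refl) (auto simp: attach_prob_def max_tree_def)
  also have "\<dots> = real (\<Sum>s\<in>max_tree n E r. deg E s) / (2 * real n + 1)"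
    by (simp add: sum_divide_distrib add.commute)
  also have "real (\<Sum>s\<in>max_tree n E r. deg E s) =
      2 * real (card (max_tree n E r)) - of_bool ((r, r) \<notin> E)"
    using arg_cong[OF sum_deg_max_tree[OF attachment_graph_G1[OF n E] r], of real] by simp
  finally show ?thesis by (simp add: field_simps)
qed

text \<open>The test function also sees whether \<open>r\<close> has a loop: this decides the urn
  weights, and the edge of a later vertex cannot change it. Together with the size it forms a Markov
  chain.\<close>

lemma expectation_attach_max_tree:
  fixes h :: "bool \<Rightarrow> nat \<Rightarrow> real"
  assumes E: "E \<in> set_pmf (G1 n)" and r: "r \<in> {1..n}"
  defines "X \<equiv> card (max_tree n E r)"
  defines "q \<equiv> (real X - of_bool ((r, r) \<notin> E) / 2) / (real n + 1 / 2)"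
  shows "measure_pmf.expectation (attach_pmf (Suc n) E)
      (\<lambda>s. h ((r, r) \<in> insert (Suc n, s) E) (card (max_tree (Suc n) (insert (Suc n, s) E) r))) =
    q * h ((r, r) \<in> E) (Suc X) + (1 - q) * h ((r, r) \<in> E) X"
proof -
  let ?T = "max_tree n E r" and ?b = "(r, r) \<in> E"
  have G: "attachment_graph n E" using E r by (intro attachment_graph_G1) auto
  have "Suc n \<notin> ?T" by (simp add: max_tree_def)
  then have "(\<lambda>s. h ((r, r) \<in> insert (Suc n, s) E) (card (max_tree (Suc n) (insert (Suc n, s) E) r))) =
      (\<lambda>s. h ?b X + (h ?b (Suc X) - h ?b X) * indicator ?T s)"
    using r by (auto simp: max_tree_insert[OF G r] X_def fun_eq_iff split: split_indicator)
  then have "measure_pmf.expectation (attach_pmf (Suc n) E)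
      (\<lambda>s. h ((r, r) \<in> insert (Suc n, s) E) (card (max_tree (Suc n) (insert (Suc n, s) E) r))) =
      h ?b X + (h ?b (Suc X) - h ?b X) * measure_pmf.prob (attach_pmf (Suc n) E) ?T"
    by (simp add: measure_pmf.emeasure_eq_measure)
  also have "\<dots> = q * h ?b (Suc X) + (1 - q) * h ?b X"
    unfolding prob_attach_max_tree[OF E r] X_def[symmetric] q_def[symmetric] by (simp add: algebra_simps)
  finally show ?thesis .
qed

lemma max_tree_root_newest:
  assumes "attachment_graph r E" "r \<ge> 1"
  shows "max_tree r E r = {r}"
  using attachment_graph_rtrancl_le[OF assms(1)] assms(2) by (fastforce simp: max_tree_def)

text \<open>Source of the mixture weights: vertex \<open>r\<close> takes a loop with probability
  \<open>1 / (2 * r - 1)\<close> when it is added.\<close>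

lemma expectation_loop_newest:
  assumes "r \<ge> 1"
  shows "measure_pmf.expectation (G1 r) (\<lambda>E. if (r, r) \<in> E then u else w) =
    1 / (2 * real r - 1) * u + 2 * (real r - 1) / (2 * real r - 1) * (w::real)"
\<comment> \<open>The initial state has a sure loop and is not produced by an attachment step; the
  second weight is then zero.\<close>
proof (cases "r = 1")
  case True
  then show ?thesis by simp
next
  case False
  then obtain n where n: "r = Suc n" "n \<ge> 1" using assms by (cases r) auto
  have "measure_pmf.expectation (G1 r) (\<lambda>E. if (r, r) \<in> E then u else w) =
      measure_pmf.expectation (G1 n) (\<lambda>E. measure_pmf.expectation (attach_pmf r E)
        (\<lambda>s. if (r, r) \<in> insert (r, s) E then u else w))"
    using expectation_G1_Suc[OF n(2)] n(1) by simp
  also have "\<dots> = measure_pmf.expectation (G1 n) (\<lambda>E. w + (u - w) * (1 / (2 * real r - 1)))"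
  proof (intro integral_cong_AE AE_pmfI)
    fix E assume E: "E \<in> set_pmf (G1 n)"
    have "(r, r) \<notin> E"
      using attachment_graph_edge(1)[OF attachment_graph_G1[OF n(2) E], of r r] n by auto
    then have "(\<lambda>s. if (r, r) \<in> insert (r, s) E then u else w) = (\<lambda>s. w + (u - w) * indicator {r} s)"
      by (auto simp: fun_eq_iff split: split_indicator)
    then have "measure_pmf.expectation (attach_pmf r E) (\<lambda>s. if (r, r) \<in> insert (r, s) E then u else w) =
        w + (u - w) * pmf (attach_pmf r E) r"
      by (simp add: measure_pmf_single measure_pmf.emeasure_eq_measure)
    also have "pmf (attach_pmf r E) r = 1 / (2 * real r - 1)"
      using pmf_attach_pmf_G1[OF n(2) E, of r] n by (simp add: attach_prob_def)
    finally show "measure_pmf.expectation (attach_pmf r E)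
        (\<lambda>s. if (r, r) \<in> insert (r, s) E then u else w) = w + (u - w) * (1 / (2 * real r - 1))" .
  qed auto
  also have "\<dots> = w + (u - w) * (1 / (2 * real r - 1))"
    by simp
  also have "\<dots> = 1 / (2 * real r - 1) * u + 2 * (real r - 1) / (2 * real r - 1) * w"
  proof -
    have "2 * (real r - 1) / (2 * real r - 1) = 1 - 1 / (2 * real r - 1)"
      using assms by (simp add: field_simps)
    moreover have "w + (u - w) * c = c * u + (1 - c) * w" for c
      by (simp add: algebra_simps)
    ultimately show ?thesis by (simp only:)
  qed
  finally show ?thesis .
qed

section \<open>Exact law of the tree size and its limit\<close>

text \<open>At time \<open>r\<close> the tree is a single vertex. With \<open>Suc k\<close> vertices
  at time \<open>N + r\<close>, the probability of growth is \<open>(1 + k) / (N + r + 1/2)\<close>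
  with a loop and \<open>(1/2 + k) / (N + r + 1/2)\<close> without; matching this with
  \<open>(a + k) / (a + b + N)\<close> yields the parameters. The test function is arbitrary in the
  induction, as each step replaces it by its one-step average.\<close>

lemma expectation_max_tree:
  fixes h :: "bool \<Rightarrow> nat \<Rightarrow> real"
  assumes r: "r \<ge> 1"
  shows "measure_pmf.expectation (G1 (N + r)) (\<lambda>E. h ((r, r) \<in> E) (card (max_tree (N + r) E r))) =
    1 / (2 * real r - 1) * (\<Sum>k\<le>N. beta_binomial 1 (real r - 1 / 2) N k * h True (Suc k)) +
    2 * (real r - 1) / (2 * real r - 1) * (\<Sum>k\<le>N. beta_binomial (1 / 2) (real r) N k * h False (Suc k))"
proof (induction N arbitrary: h)
  case 0
  have "measure_pmf.expectation (G1 r) (\<lambda>E. h ((r, r) \<in> E) (card (max_tree r E r))) =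
      measure_pmf.expectation (G1 r) (\<lambda>E. if (r, r) \<in> E then h True 1 else h False 1)"
    by (intro integral_cong_AE AE_pmfI)
      (use max_tree_root_newest[OF attachment_graph_G1[OF r] r] in auto)
  then show ?case
    using r by (simp add: expectation_loop_newest beta_binomial_0_0)
next
  case (Suc N)
  define q where "q b x = (real x - of_bool (\<not> b) / 2) / (real (N + r) + 1 / 2)" for b and x :: nat
  have "measure_pmf.expectation (G1 (Suc N + r))
        (\<lambda>E. h ((r, r) \<in> E) (card (max_tree (Suc N + r) E r))) =
      measure_pmf.expectation (G1 (N + r)) (\<lambda>E. measure_pmf.expectation (attach_pmf (Suc (N + r)) E)
        (\<lambda>s. h ((r, r) \<in> insert (Suc (N + r), s) E)
          (card (max_tree (Suc (N + r)) (insert (Suc (N + r), s) E) r))))"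
    using r by (simp add: expectation_G1_Suc)
  \<comment> \<open>The average is kept as a function applied to loop flag and size, the shape to
    which \<open>Suc.IH\<close> applies.\<close>
  also have "\<dots> = measure_pmf.expectation (G1 (N + r)) (\<lambda>E. (\<lambda>b x. q b x * h b (Suc x) + (1 - q b x) * h b x)
      ((r, r) \<in> E) (card (max_tree (N + r) E r)))"
  proof (intro integral_cong_AE AE_pmfI)
    fix E assume "E \<in> set_pmf (G1 (N + r))"
    then show "measure_pmf.expectation (attach_pmf (Suc (N + r)) E)
        (\<lambda>s. h ((r, r) \<in> insert (Suc (N + r), s) E)
          (card (max_tree (Suc (N + r)) (insert (Suc (N + r), s) E) r))) =
        (\<lambda>b x. q b x * h b (Suc x) + (1 - q b x) * h b x) ((r, r) \<in> E) (card (max_tree (N + r) E r))"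
      unfolding q_def using r by (intro expectation_attach_max_tree) auto
  qed auto
  also note Suc.IH
  also have "(\<Sum>k\<le>N. beta_binomial 1 (real r - 1 / 2) N k *
        (q True (Suc k) * h True (Suc (Suc k)) + (1 - q True (Suc k)) * h True (Suc k))) =
      (\<Sum>k\<le>Suc N. beta_binomial 1 (real r - 1 / 2) (Suc N) k * h True (Suc k))"
    using r by (subst beta_binomial_step[symmetric]) (auto simp: q_def add_ac)
  also have "(\<Sum>k\<le>N. beta_binomial (1 / 2) (real r) N k *
        (q False (Suc k) * h False (Suc (Suc k)) + (1 - q False (Suc k)) * h False (Suc k))) =
      (\<Sum>k\<le>Suc N. beta_binomial (1 / 2) (real r) (Suc N) k * h False (Suc k))"
    using r by (subst beta_binomial_step[symmetric]) (auto simp: q_def add_ac)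
  finally show ?case .
qed

theorem theorem4p6:
  fixes r :: nat
  assumes "r \<ge> 1"
  shows "weak_conv_m
    (\<lambda>n. distr (measure_pmf (G1 n)) borel (\<lambda>E. real (card (max_tree n E r)) / real n))
    (mixture (1 / (2 * real r - 1)) (beta_dist 1 (real r - 1 / 2))
             (2 * (real r - 1) / (2 * real r - 1)) (beta_dist (1 / 2) (real r)))"
\<comment> \<open>Piecewise linear step functions suffice as test functions; they are bounded and
  uniformly continuous, as \<open>beta_binomial_tendsto\<close> requires.\<close>
proof (rule integral_cts_step_conv_imp_weak_conv)
  let ?p = "1 / (2 * real r - 1)" and ?q = "2 * (real r - 1) / (2 * real r - 1)"
  have pq: "?p \<ge> 0" "?q \<ge> 0" and pq1: "?p + ?q = 1"
    using assms by (auto simp: field_simps)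
  have par: "real r - 1 / 2 > 0" "real r > 0" using assms by auto
  show "real_distribution (distr (measure_pmf (G1 n)) borel (\<lambda>E. real (card (max_tree n E r)) / real n))" for n
    by (simp add: real_distribution_def real_distribution_axioms_def measure_pmf.prob_space_distr)
  show "real_distribution (mixture ?p (beta_dist 1 (real r - 1 / 2)) ?q (beta_dist (1 / 2) (real r)))"
    using pq pq1 par by (intro real_distribution_mixture_beta_dist) auto
  fix x y :: real assume xy: "x < y"
  let ?f = "cts_step x y"
  note uc = cts_step_uniformly_continuous[OF xy]
  have bd: "\<bar>?f z\<bar> \<le> 1" for z using xy by (auto simp: cts_step_def)
  have fm: "?f \<in> borel_measurable borel"
    using uniformly_continuous_imp_continuous[OF uc] by (rule borel_measurable_continuous_onI)
  have "(\<lambda>N. ?p * (\<Sum>k\<le>N. beta_binomial 1 (real r - 1 / 2) N k * ?f (real (Suc k) / real (N + r))) +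
        ?q * (\<Sum>k\<le>N. beta_binomial (1 / 2) (real r) N k * ?f (real (Suc k) / real (N + r))))
      \<longlonglongrightarrow> ?p * (LINT z|lborel. ?f z * beta_density 1 (real r - 1 / 2) z) +
        ?q * (LINT z|lborel. ?f z * beta_density (1 / 2) (real r) z)"
    using par assms
    by (intro tendsto_add tendsto_mult tendsto_const beta_binomial_tendsto[OF _ _ _ uc bd]) auto
  \<comment> \<open>The test function here ignores the loop flag, so both urns are evaluated at the
    same function of the size.\<close>
  moreover have "integral\<^sup>L (distr (measure_pmf (G1 (N + r))) borel
        (\<lambda>E. real (card (max_tree (N + r) E r)) / real (N + r))) ?f =
      ?p * (\<Sum>k\<le>N. beta_binomial 1 (real r - 1 / 2) N k * ?f (real (Suc k) / real (N + r))) +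
        ?q * (\<Sum>k\<le>N. beta_binomial (1 / 2) (real r) N k * ?f (real (Suc k) / real (N + r)))" for N
    using expectation_max_tree[OF assms, of N "\<lambda>_ m. ?f (real m / real (N + r))"] fm
    by (subst integral_distr) auto
  moreover have "integral\<^sup>L (mixture ?p (beta_dist 1 (real r - 1 / 2)) ?q (beta_dist (1 / 2) (real r))) ?f =
      ?p * (LINT z|lborel. ?f z * beta_density 1 (real r - 1 / 2) z) +
        ?q * (LINT z|lborel. ?f z * beta_density (1 / 2) (real r) z)"
    using pq par by (intro integral_mixture_beta_dist[OF _ _ _ _ _ _ fm bd]) auto
  \<comment> \<open>The limit was found along \<open>n = N + r\<close>; dropping the first
    \<open>r\<close> terms does not affect it.\<close>
  ultimately show "(\<lambda>n. integral\<^sup>L (distr (measure_pmf (G1 n)) borel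
        (\<lambda>E. real (card (max_tree n E r)) / real n)) ?f) \<longlonglongrightarrow>
      integral\<^sup>L (mixture ?p (beta_dist 1 (real r - 1 / 2)) ?q (beta_dist (1 / 2) (real r))) ?f"
    by (simp only: LIMSEQ_offset[of _ r])
qed

end
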